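(* Let $g:\mathbb{R}^n\to\mathbb{R}^m$ be an affine map and let $P\subset\mathbb{R}^m$ be non-empty, convex and compact. Suppose that (i) $M:P\rightrightarrows\mathbb{R}^n$ is a convex-valued, lower semi-continuous and closed multi-valued map such that $M(p)$ has non-empty interior for each $p\in P$; (ii) $G:\mathbb{R}^n\rightrightarrows\mathbb{R}^n$ is locally upper sign-continuous, dually lower semi-continuous and quasimonotone over the set $\mathrm{co}(M(P))$, where $M(P)=\bigcup_{p\in P}M(p)$. Assume that the coercivity condition $\mathcal{C}(p)$ holds, with constant $r_p>0$, for each $p\in P$, and that there exists some $r>\sup\{r_p : p\in P\}$ such that $M(p)\cap\bar B(0,r)\neq\emptyset$ for every $p\in P$. Then there exist $\bar p\in P$, $\bar y\in M(\bar p)$ and $\bar y^*\in G(\bar y)\setminus\{0\}$ such that $$\langle g(\bar y),p-\bar p\rangle+\langle\bar y^*,z-\bar y\rangle\ge 0\quad\text{for all }(p,z)\in P\times M(\bar p).$$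
   Context: $\bar B(0,r)$ is the closed Euclidean ball of radius $r$ centred at $0$; $\mathrm{co}$ denotes convex hull. A multi-valued map is closed if its graph is closed. Coercivity condition $\mathcal{C}(p)$ with constant $r_p>0$: for every $y\in M(p)\setminus\bar B(0,r_p)$ there exists $z\in M(p)$ with $\|z\|<\|y\|$ such that $\langle y^*,y-z\rangle\ge 0$ for each $y^*\in G(y)$. A map $T:\mathbb{R}^n\rightrightarrows\mathbb{R}^n$ is quasimonotone over $K\subseteq\mathbb{R}^n$ if for all $v,w\in K$: if there exists $v^*\in T(v)$ with $\langle v^*,w-v\rangle> 0$, then $\langle w^*,w-v\rangle\ge 0$ for all $w^*\in T(w)$. A map $T$ is dually lower semi-continuous over $K$ if for each $v\in K$ and any sequence $(u_n)$ in $K$ with $u_n\to u$ ($u\in K$): $\liminf_n\sup_{u_n^*\in T(u_n)}\langle u_n^*,v-u_n\rangle\le 0$ implies $\sup_{u^*\in T(u)}\langle u^*,v-u\rangle\le 0$. A map $T$ is upper sign-continuous over a convex set $K$ if for all $u,v\in K$, with $u_s=su+(1-s)v$: if $\inf_{u_s^*\in T(u_s)}\langle u_s^*,v-u\rangle\ge 0$ for all $s\in(0,1)$, then $\sup_{u^*\in T(u)}\langle u^*,v-u\rangle\ge 0$. A map $T:\mathbb{R}^n\rightrightarrows\mathbb{R}^n$ is locally upper sign-continuous at $u$ if there are a convex open set $\mathcal{O}_u$ containing $u$ and a map $\psi_u:\mathcal{O}_u\rightrightarrows\mathbb{R}^n$ that is upper sign-continuous over $\mathcal{O}_u$ and such that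 $\psi_u(\tilde u)$ is a non-empty convex compact subset of $T(\tilde u)\setminus\{0\}$ for every $\tilde u\in\mathcal{O}_u$. It is locally upper sign-continuous over a set if it is so at each point of the set. *)

theory Defs
  imports "HOL-Analysis.Analysis"
begin

text \<open>
  A multi-valued map from \<open>X\<close> to \<open>Y\<close> is a function into sets, of which only the values at
  points of \<open>X\<close> matter; values may be empty.  Suprema, infima and lower limits of
  pairings are taken in \<^typ>\<open>ereal\<close>, so that unbounded sets are treated correctly and the
  supremum and infimum over the empty set are \<open>-\<infinity>\<close> and \<open>\<infinity>\<close>.
\<close>

definition affine_map :: "('a::real_vector \<Rightarrow> 'b::real_vector) \<Rightarrow> bool" where
  "affine_map g \<longleftrightarrow> (\<exists>L c. linear L \<and> (\<forall>x. g x = L x + c))"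

definition lsc_multimap_on ::
    "'a::topological_space set \<Rightarrow> ('a \<Rightarrow> 'b::topological_space set) \<Rightarrow> bool" where
  "lsc_multimap_on X M \<longleftrightarrow>
     (\<forall>V. open V \<longrightarrow> openin (top_of_set X) {x \<in> X. M x \<inter> V \<noteq> {}})"

definition closed_multimap_on ::
    "'a::topological_space set \<Rightarrow> ('a \<Rightarrow> 'b::topological_space set) \<Rightarrow> bool" where
  "closed_multimap_on X M \<longleftrightarrow> closed (Sigma X M)"

definition quasimonotone_on :: "'a::real_inner set \<Rightarrow> ('a \<Rightarrow> 'a set) \<Rightarrow> bool" where
  "quasimonotone_on K T \<longleftrightarrow>
     (\<forall>v\<in>K. \<forall>w\<in>K. (\<exists>v'\<in>T v. v' \<bullet> (w - v) > 0) \<longrightarrow> (\<forall>w'\<in>T w. w' \<bullet> (w - v) \<ge> 0))"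

definition dually_lsc_on :: "'a::real_inner set \<Rightarrow> ('a \<Rightarrow> 'a set) \<Rightarrow> bool" where
  "dually_lsc_on K T \<longleftrightarrow>
     (\<forall>v\<in>K. \<forall>u\<in>K. \<forall>x :: nat \<Rightarrow> 'a. (\<forall>n. x n \<in> K) \<and> x \<longlonglongrightarrow> u \<longrightarrow>
        liminf (\<lambda>n. SUP x'\<in>T (x n). ereal (x' \<bullet> (v - x n))) \<le> 0 \<longrightarrow>
        (SUP u'\<in>T u. ereal (u' \<bullet> (v - u))) \<le> 0)"

definition upper_sign_continuous_on :: "'a::real_inner set \<Rightarrow> ('a \<Rightarrow> 'a set) \<Rightarrow> bool" where
  "upper_sign_continuous_on K T \<longleftrightarrow>
     (\<forall>u\<in>K. \<forall>v\<in>K.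
        (\<forall>s\<in>{0<..<1::real}.
           (INF x'\<in>T (s *\<^sub>R u + (1 - s) *\<^sub>R v). ereal (x' \<bullet> (v - u))) \<ge> 0) \<longrightarrow>
        (SUP u'\<in>T u. ereal (u' \<bullet> (v - u))) \<ge> 0)"

definition locally_upper_sign_continuous_at :: "'a::real_inner \<Rightarrow> ('a \<Rightarrow> 'a set) \<Rightarrow> bool" where
  "locally_upper_sign_continuous_at u T \<longleftrightarrow>
     (\<exists>U \<psi>. open U \<and> convex U \<and> u \<in> U \<and> upper_sign_continuous_on U \<psi> \<and>
        (\<forall>x\<in>U. \<psi> x \<noteq> {} \<and> convex (\<psi> x) \<and> compact (\<psi> x) \<and> \<psi> x \<subseteq> T x - {0}))"

definition locally_upper_sign_continuous_on :: "'a::real_inner set \<Rightarrow> ('a \<Rightarrow> 'a set) \<Rightarrow> bool" where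
  "locally_upper_sign_continuous_on K T \<longleftrightarrow> (\<forall>u\<in>K. locally_upper_sign_continuous_at u T)"

definition coercive_at ::
    "('p \<Rightarrow> 'a::real_inner set) \<Rightarrow> ('a \<Rightarrow> 'a set) \<Rightarrow> 'p \<Rightarrow> real \<Rightarrow> bool" where
  "coercive_at M G p \<rho> \<longleftrightarrow>
     (\<forall>y \<in> M p - cball 0 \<rho>. \<exists>z \<in> M p. norm z < norm y \<and> (\<forall>y'\<in>G y. y' \<bullet> (y - z) \<ge> 0))"

end

theory Submission
  imports Defs
begin

text \<open>
  On a set with non-empty interior, a solution of the Stampacchia variational inequality with
  a nonzero dual element is strict at interior points, so quasimonotonicity makes it a Minty
  solution there and dual lower semi-continuity extends this to the whole set.  Conversely,
  local upper sign-continuity turns every (even local) Minty solution into a Stampacchia solution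
  with a nonzero dual element.  So on the truncations \<open>M p \<inter> cball 0 r\<close> the two
  notions agree, and Minty solution sets are convex and depend on \<open>p\<close> with closed graph.
  Kakutani's theorem, applied to the product of \<open>y \<mapsto> argmin\<^sub>P (g y \<bullet> _)\<close>
  and this solution map, gives the required point; coercivity removes the truncation.

  A Minty solution exists because otherwise the sets where the Minty inequality fails for some
  \<open>z\<close> cover the constraint set; Brouwer's theorem then gives a point that is a convex
  combination of those \<open>z\<close> for which the inequality fails at the point itself, and
  quasimonotonicity makes this point a local Minty solution after all.
\<close>

section \<open>Preliminaries, and fixed points from Brouwer's theorem\<close>

lemma closed_Sigma_value:
  assumes "closed (Sigma X F)" "x \<in> X"
  shows "closed (F x)"
proof -
  have "closed (Pair x -` Sigma X F)"
    by (rule closed_vimage[OF assms(1)]) (intro continuous_intros)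
  also have "Pair x -` Sigma X F = F x" using assms(2) by auto
  finally show ?thesis .
qed

lemma small_scaling:
  fixes v :: "'a::real_normed_vector"
  assumes "m > 0"
  obtains t where "t > 0" "t \<le> 1" "t * norm v < m"
proof
  define t where "t = min 1 (m / (1 + norm v))"
  show "t > 0" "t \<le> 1" using assms by (auto simp: t_def add_pos_nonneg)
  have "t * norm v \<le> m / (1 + norm v) * norm v"
    unfolding t_def by (intro mult_right_mono) auto
  also have "\<dots> < m"
    using assms by (simp add: divide_simps add_pos_nonneg algebra_simps)
  finally show "t * norm v < m" .
qed

text \<open>Weighting the fields \<open>v i\<close> of a finite subcover by the distance to
  \<open>V i\<close> gives one continuous field, and Brouwer's theorem solves its variational
  inequality. The weights vanish exactly on \<open>V i\<close>, so at the solution only indices with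
  \<open>x \<notin> V j\<close> survive. The Kakutani, minimax and Minty existence arguments are all
  instances of this.\<close>

lemma selection_variational_inequality:
  fixes X :: "'a::euclidean_space set" and V :: "'i \<Rightarrow> 'a set" and v :: "'i \<Rightarrow> 'a \<Rightarrow> 'a"
  assumes X: "compact X" "convex X" "X \<noteq> {}"
    and V: "\<And>i. i \<in> I \<Longrightarrow> closed (V i)"
    and v: "\<And>i. i \<in> I \<Longrightarrow> continuous_on X (v i)"
    and cov: "\<And>x. x \<in> X \<Longrightarrow> \<exists>i\<in>I. x \<notin> V i"
  obtains x J and t :: "'i \<Rightarrow> real"
    where "x \<in> X" "finite J" "J \<subseteq> I" "J \<noteq> {}" "\<And>j. j \<in> J \<Longrightarrow> x \<notin> V j" "\<And>j. j \<in> J \<Longrightarrow> t j > 0"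
      "\<And>w. w \<in> X \<Longrightarrow> (\<Sum>j\<in>J. t j *\<^sub>R v j x) \<bullet> (w - x) \<ge> 0"
proof -
  have "X \<subseteq> (\<Union>i\<in>I. - V i)" using cov by blast
  then obtain I0 where I0: "I0 \<subseteq> I" "finite I0" "X \<subseteq> (\<Union>i\<in>I0. - V i)"
    using compactE_image[OF X(1), of I "\<lambda>i. - V i"] V by (metis open_Compl)
  \<comment> \<open>\<open>infdist\<close> to the empty set is 0 by convention, so the empty
    \<open>V i\<close> needs its own positive weight.\<close>
  define \<phi> where "\<phi> i x = (if V i = {} then 1 else infdist x (V i))" for i x
  have \<phi>_cont: "continuous_on X (\<phi> i)" for i
    unfolding \<phi>_def by (cases "V i = {}") (auto intro!: continuous_intros)
  have \<phi>_pos: "\<phi> i x > 0 \<longleftrightarrow> x \<notin> V i" if "i \<in> I0" for i x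
  proof (cases "V i = {}")
    case False
    then show ?thesis
      using V[of i] that I0(1) in_closed_iff_infdist_zero[of "V i" x] infdist_nonneg[of x "V i"]
      unfolding \<phi>_def by (auto simp: less_le)
  qed (simp add: \<phi>_def)
  have \<phi>_nonneg: "\<phi> i x \<ge> 0" for i x
    by (simp add: \<phi>_def infdist_nonneg)
  define a where "a x = (\<Sum>i\<in>I0. \<phi> i x *\<^sub>R v i x)" for x
  have a_cont: "continuous_on X a"
    unfolding a_def using I0(1) by (auto intro!: continuous_intros \<phi>_cont v)
  \<comment> \<open>A fixed point of this projected step satisfies
    \<open>a x \<bullet> (w - x) \<ge> 0\<close> for all \<open>w\<close> in \<open>X\<close>, by
    the obtuse-angle property of the closest point.\<close>
  define f where "f x = closest_point X (x - a x)" for x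
  have clX: "closed X" using X(1) by (rule compact_imp_closed)
  have "continuous_on X f"
    unfolding f_def
    by (rule continuous_on_compose2[OF continuous_on_closest_point[OF X(2) clX X(3), of UNIV]])
       (auto intro!: continuous_intros a_cont)
  moreover have "f \<in> X \<rightarrow> X"
    unfolding f_def using closest_point_in_set[OF clX X(3)] by blast
  ultimately obtain x where x: "x \<in> X" "f x = x"
    using brouwer[OF X] by blast
  define J where "J = {i \<in> I0. x \<notin> V i}"
  have ax: "a x = (\<Sum>j\<in>J. \<phi> j x *\<^sub>R v j x)"
    unfolding a_def
  proof (rule sum.mono_neutral_right[OF I0(2)])
    show "\<forall>i\<in>I0 - J. \<phi> i x *\<^sub>R v i x = 0"
    proof
      fix i assume i: "i \<in> I0 - J"
      then have "\<not> \<phi> i x > 0" using \<phi>_pos[of i x] by (simp add: J_def)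
      then show "\<phi> i x *\<^sub>R v i x = 0" using \<phi>_nonneg[of i x] by simp
    qed
  qed (auto simp: J_def)
  show thesis
  proof (rule that[of x J "\<lambda>j. \<phi> j x"])
    show "J \<noteq> {}" using I0(3) x(1) unfolding J_def by blast
    show "(\<Sum>j\<in>J. \<phi> j x *\<^sub>R v j x) \<bullet> (w - x) \<ge> 0" if "w \<in> X" for w
      using closest_point_dot[OF X(2) clX that, of "x - a x"] x(2)
      unfolding ax[symmetric] f_def by simp
  qed (use x I0 \<phi>_pos in \<open>auto simp: J_def\<close>)
qed

text \<open>Without a fixed point, every \<open>x\<close> is strictly separated from
  \<open>F x\<close> by some vector. The selection lemma with constant fields \<open>a\<close>
  yields an \<open>x\<close> and a positive combination of vectors, each strictly negative on
  \<open>F x - x\<close>, whereas the combination is nonnegative on \<open>X - x\<close>.\<close>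

theorem kakutani:
  fixes X :: "'a::euclidean_space set" and F :: "'a \<Rightarrow> 'a set"
  assumes X: "compact X" "convex X" "X \<noteq> {}"
    and F: "\<And>x. x \<in> X \<Longrightarrow> F x \<noteq> {}" "\<And>x. x \<in> X \<Longrightarrow> convex (F x)" "\<And>x. x \<in> X \<Longrightarrow> F x \<subseteq> X"
    and graph: "closed (Sigma X F)"
  obtains x where "x \<in> X" "x \<in> F x"
proof (rule ccontr)
  assume "\<not> thesis"
  then have nofix: "x \<notin> F x" if "x \<in> X" for x
    using that \<open>\<And>x. x \<in> X \<Longrightarrow> x \<in> F x \<Longrightarrow> thesis\<close> by blast
  \<comment> \<open>the points that \<open>a\<close> does not strictly separate from their image\<close>
  define V where "V a = fst ` (Sigma X F \<inter> {(x, w). a \<bullet> (w - x) \<ge> 0})" for a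
  have "Sigma X F \<subseteq> X \<times> X" using F(3) by blast
  then have cG: "compact (Sigma X F)"
    using compact_Int_closed[OF compact_Times[OF X(1) X(1)] graph] by (simp add: Int_absorb1)
  have closedV: "closed (V a)" for a
  proof -
    have "closed {z :: 'a \<times> 'a. a \<bullet> (snd z - fst z) \<ge> 0}"
      by (intro closed_Collect_le continuous_intros)
    then have "closed {(x, w). a \<bullet> (w - x) \<ge> 0}"
      by (simp add: case_prod_beta')
    then have "compact (V a)"
      unfolding V_def
      by (intro compact_continuous_image compact_Int_closed[OF cG] continuous_intros)
    then show ?thesis by (rule compact_imp_closed)
  qed
  have cov: "\<exists>a\<in>UNIV. x \<notin> V a" if x: "x \<in> X" for x
  proof -
    obtain a b where ab: "a \<bullet> x < b" "\<forall>w\<in>F x. a \<bullet> w > b"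
      using separating_hyperplane_closed_point[OF F(2)[OF x] closed_Sigma_value[OF graph x] nofix[OF x]]
      by blast
    then have "x \<notin> V (- a)"
      unfolding V_def by (force simp: inner_diff_right)
    then show ?thesis by blast
  qed
  obtain x J and t :: "'a \<Rightarrow> real" where x: "x \<in> X" "finite J" "J \<noteq> {}"
      "\<And>a. a \<in> J \<Longrightarrow> x \<notin> V a" "\<And>a. a \<in> J \<Longrightarrow> t a > 0"
      "\<And>w. w \<in> X \<Longrightarrow> (\<Sum>a\<in>J. t a *\<^sub>R a) \<bullet> (w - x) \<ge> 0"
    by (rule selection_variational_inequality[OF X, of UNIV V "\<lambda>a _. a"])
       (rule closedV, rule continuous_on_const, erule cov, blast)
  obtain w where w: "w \<in> F x" using F(1) x(1) by blast
  have "t a * (a \<bullet> (w - x)) < 0" if "a \<in> J" for a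
  proof -
    have "a \<bullet> (w - x) < 0"
      using x(4)[OF that] x(1) w unfolding V_def by force
    then show ?thesis using x(5)[OF that] by (simp add: mult_pos_neg)
  qed
  then have "(\<Sum>a\<in>J. t a * (a \<bullet> (w - x))) < 0"
    using x(2,3) by (simp add: sum_strict_mono[of J _ "\<lambda>_. 0", simplified])
  moreover have "(\<Sum>a\<in>J. t a *\<^sub>R a) \<bullet> (w - x) \<ge> 0"
    using x(6) F(3) x(1) w by blast
  ultimately show False by (simp add: inner_sum_left)
qed

section \<open>A minimax principle and stability of interior points\<close>

lemma convex_normalized_sum:
  fixes t :: "'i \<Rightarrow> real" and z :: "'i \<Rightarrow> 'a::real_vector"
  assumes "convex C" "finite J" "J \<noteq> {}" "\<And>j. j \<in> J \<Longrightarrow> t j > 0" "\<And>j. j \<in> J \<Longrightarrow> z j \<in> C"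
  shows "(1 / sum t J) *\<^sub>R (\<Sum>j\<in>J. t j *\<^sub>R z j) \<in> C"
proof -
  have pos: "sum t J > 0" using assms by (simp add: sum_pos)
  have "(\<Sum>j\<in>J. (t j / sum t J) *\<^sub>R z j) \<in> C"
    using assms pos by (intro convex_sum) (auto simp: sum_divide_distrib[symmetric] less_imp_le)
  then show ?thesis by (simp add: scaleR_sum_right)
qed

text \<open>This makes the choice of \<open>u\<close> uniform in \<open>z\<close>. Otherwise some
  \<open>u\<close> in \<open>D\<close> is negative on \<open>z - y\<close> for finitely many
  \<open>z\<close>, hence also on \<open>c - y\<close> for a weighted mean \<open>c\<close> of them;
  the fields \<open>y - z\<close> make this \<open>u\<close> maximize the pairing with
  \<open>c - y\<close> over \<open>D\<close>, so \<open>ex\<close> fails at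
  \<open>c\<close>.\<close>

lemma minimax_inner:
  fixes C D :: "'a::euclidean_space set"
  assumes D: "compact D" "convex D" "D \<noteq> {}" and C: "convex C"
    and ex: "\<And>z. z \<in> C \<Longrightarrow> \<exists>u\<in>D. u \<bullet> (z - y) \<ge> 0"
  obtains u where "u \<in> D" "\<And>z. z \<in> C \<Longrightarrow> u \<bullet> (z - y) \<ge> 0"
proof (rule ccontr)
  assume "\<not> thesis"
  then have cov: "\<exists>z\<in>C. u \<notin> {u. u \<bullet> (z - y) \<ge> 0}" if "u \<in> D" for u
    using \<open>\<And>u. u \<in> D \<Longrightarrow> (\<And>z. z \<in> C \<Longrightarrow> 0 \<le> u \<bullet> (z - y)) \<Longrightarrow> thesis\<close> that by blast
  have cl: "closed {u. u \<bullet> (z - y) \<ge> 0}" for z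
    by (intro closed_Collect_le continuous_intros)
  obtain u J and t :: "'a \<Rightarrow> real" where u: "u \<in> D" "finite J" "J \<subseteq> C" "J \<noteq> {}"
      "\<And>z. z \<in> J \<Longrightarrow> u \<notin> {u. u \<bullet> (z - y) \<ge> 0}" "\<And>z. z \<in> J \<Longrightarrow> t z > 0"
      "\<And>w. w \<in> D \<Longrightarrow> (\<Sum>z\<in>J. t z *\<^sub>R (y - z)) \<bullet> (w - u) \<ge> 0"
    by (rule selection_variational_inequality[OF D, of C "\<lambda>z. {u. u \<bullet> (z - y) \<ge> 0}" "\<lambda>z _. y - z"])
       (rule cl, rule continuous_on_const, erule cov, blast)
  let ?T = "sum t J"
  define c where "c = (1 / ?T) *\<^sub>R (\<Sum>z\<in>J. t z *\<^sub>R z)"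
  have T: "?T > 0" using u by (simp add: sum_pos)
  have "c \<in> C" unfolding c_def using u by (intro convex_normalized_sum C) auto
  then obtain w where w: "w \<in> D" "w \<bullet> (c - y) \<ge> 0" using ex by blast
  have eq: "(\<Sum>z\<in>J. t z *\<^sub>R (y - z)) = ?T *\<^sub>R (y - c)"
    unfolding c_def using T by (simp add: scaleR_diff_right sum_subtractf scaleR_sum_left)
  have "(\<Sum>z\<in>J. t z *\<^sub>R (y - z)) \<bullet> u > 0"
    unfolding inner_sum_left using u
    by (intro sum_pos) (auto simp: inner_diff_right inner_diff_left inner_commute not_le)
  with u(7)[OF w(1)] eq have "?T * ((y - c) \<bullet> w) > 0"
    by (simp add: inner_diff_right)
  then have "(y - c) \<bullet> w > 0" using T by (simp add: zero_less_mult_iff)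
  then show False using w(2) by (simp add: inner_diff_left inner_diff_right inner_commute)
qed

text \<open>Lower semi-continuity alone only provides points of \<open>M q\<close> near
  \<open>z\<close>. Convexity in finite dimension upgrades this: a convex set that comes close to
  every point of a sphere around \<open>z\<close> contains \<open>z\<close>.\<close>

lemma lsc_multimap_interior_stable:
  fixes M :: "'p::topological_space \<Rightarrow> 'a::euclidean_space set"
  assumes lsc: "lsc_multimap_on P M"
    and M: "\<And>q. q \<in> P \<Longrightarrow> convex (M q)" "\<And>q. q \<in> P \<Longrightarrow> closed (M q)"
    and p: "p \<in> P" "z \<in> interior (M p)"
  obtains U where "open U" "p \<in> U" "\<And>q. q \<in> P \<inter> U \<Longrightarrow> z \<in> M q"
proof -
  obtain \<delta> where \<delta>: "\<delta> > 0" "cball z \<delta> \<subseteq> M p"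
    using p(2) mem_interior_cball by blast
  have "sphere z \<delta> \<subseteq> (\<Union>c\<in>sphere z \<delta>. ball c (\<delta>/2))" using \<delta>(1) by force
  then obtain N where N: "N \<subseteq> sphere z \<delta>" "finite N" "sphere z \<delta> \<subseteq> (\<Union>c\<in>N. ball c (\<delta>/2))"
    using compactE_image[OF compact_sphere[of z \<delta>], of "sphere z \<delta>" "\<lambda>c. ball c (\<delta>/2)"]
    by (metis open_ball)
  \<comment> \<open>near \<open>p\<close>, \<open>M q\<close> meets a small ball around each point of the net, so no
    hyperplane can separate \<open>z\<close> from it\<close>
  have "\<exists>U. open U \<and> p \<in> U \<and> (\<forall>q\<in>P \<inter> U. M q \<inter> ball c (\<delta>/2) \<noteq> {})" if "c \<in> insert z N" for c
  proof -
    have "openin (top_of_set P) {x \<in> P. M x \<inter> ball c (\<delta>/2) \<noteq> {}}"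
      using lsc unfolding lsc_multimap_on_def by blast
    then obtain U where U: "open U" "{x \<in> P. M x \<inter> ball c (\<delta>/2) \<noteq> {}} = P \<inter> U"
      unfolding openin_open by blast
    have "c \<in> M p" using that N(1) \<delta> by (force simp: subset_iff)
    then have "c \<in> M p \<inter> ball c (\<delta>/2)" using \<delta>(1) by simp
    then have "p \<in> U" using U(2) p(1) by blast
    then show ?thesis using U by blast
  qed
  then obtain U where U: "\<And>c. c \<in> insert z N \<Longrightarrow> open (U c) \<and> p \<in> U c \<and> (\<forall>q\<in>P \<inter> U c. M q \<inter> ball c (\<delta>/2) \<noteq> {})"
    by metis
  show thesis
  proof (rule that[of "\<Inter>c\<in>insert z N. U c"])
    show "open (\<Inter>c\<in>insert z N. U c)" using U N(2) by (intro open_INT) auto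
    show "p \<in> (\<Inter>c\<in>insert z N. U c)" using U by blast
    fix q assume q: "q \<in> P \<inter> (\<Inter>c\<in>insert z N. U c)"
    show "z \<in> M q"
    proof (rule ccontr)
      assume "z \<notin> M q"
      then obtain a b where ab: "a \<bullet> z < b" "\<forall>w\<in>M q. a \<bullet> w > b"
        using separating_hyperplane_closed_point[of "M q" z] M q by blast
      have "M q \<noteq> {}" using U[of z] q by blast
      then have a0: "a \<noteq> 0" using ab by fastforce
      \<comment> \<open>On the sphere, \<open>a\<close> is smallest at \<open>d\<close>, by a margin
        of \<open>\<delta> * norm a\<close> below its value at \<open>z\<close>. A point of
        \<open>M q\<close> within \<open>\<delta>\<close> of \<open>d\<close> therefore still lies
        on the wrong side of the hyperplane.\<close>
      define d where "d = z - (\<delta> / norm a) *\<^sub>R a"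
      have "d \<in> sphere z \<delta>" using a0 \<delta>(1) by (simp add: d_def dist_norm)
      then obtain c where c: "c \<in> N" "d \<in> ball c (\<delta>/2)" using N(3) by blast
      then obtain w where w: "w \<in> M q" "w \<in> ball c (\<delta>/2)" using U[of c] q by blast
      have "norm (w - d) < \<delta>"
        using c(2) w(2) dist_triangle_half_r[of c w \<delta> d] by (simp add: dist_norm)
      then have "a \<bullet> (w - d) < norm a * \<delta>"
        using norm_cauchy_schwarz[of a "w - d"] a0
        by (meson le_less_trans mult_strict_left_mono zero_less_norm_iff)
      moreover have "a \<bullet> (w - d) = a \<bullet> (w - z) + \<delta> * norm a"
        using a0 by (simp add: d_def algebra_simps power2_norm_eq_inner[symmetric] power2_eq_square)
      ultimately have "a \<bullet> (w - z) < 0" by (simp add: mult.commute)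
      then show False using ab w(1) by (force simp: inner_diff_right)
    qed
  qed
qed

section \<open>Minty and Stampacchia solutions\<close>

definition minty_solutions :: "'a::real_inner set \<Rightarrow> ('a \<Rightarrow> 'a set) \<Rightarrow> 'a set" where
  "minty_solutions C G = {y \<in> C. \<forall>z\<in>C. \<forall>z'\<in>G z. z' \<bullet> (z - y) \<ge> 0}"

text \<open>Upper sign-continuity is tested along segments issuing from \<open>y\<close>, and these
  can be shortened without changing signs; hence Minty near \<open>y\<close> suffices. It gives an
  element of \<open>\<psi> y\<close> for each \<open>z\<close>, and the minimax lemma merges these
  into one, nonzero because \<open>\<psi>\<close> avoids 0.\<close>

lemma local_minty_imp_stampacchia:
  fixes G :: "'a::euclidean_space \<Rightarrow> 'a set"
  assumes lusc: "locally_upper_sign_continuous_at y G" and C: "convex C" "y \<in> C" and "e > 0"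
    and loc: "\<And>z z'. z \<in> C \<inter> ball y e \<Longrightarrow> z' \<in> G z \<Longrightarrow> z' \<bullet> (z - y) \<ge> 0"
  obtains y' where "y' \<in> G y - {0}" "\<And>z. z \<in> C \<Longrightarrow> y' \<bullet> (z - y) \<ge> 0"
proof -
  obtain U \<psi> where U: "open U" "convex U" "y \<in> U" and usc: "upper_sign_continuous_on U \<psi>"
    and \<psi>: "\<And>x. x \<in> U \<Longrightarrow> \<psi> x \<noteq> {} \<and> convex (\<psi> x) \<and> compact (\<psi> x) \<and> \<psi> x \<subseteq> G x - {0}"
    using lusc unfolding locally_upper_sign_continuous_at_def by blast
  obtain d where d: "d > 0" "ball y d \<subseteq> U"
    using U openE by blast
  have "\<exists>u\<in>\<psi> y. u \<bullet> (z - y) \<ge> 0" if z: "z \<in> C" for z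
  proof -
    \<comment> \<open>Pulling \<open>z\<close> towards \<open>y\<close> by the factor
      \<open>t\<close> keeps the whole segment where both \<open>\<psi>\<close> and the local Minty
      inequality are available.\<close>
    obtain t where t: "t > 0" "t \<le> 1" and tn: "t * norm (z - y) < min d e"
      using small_scaling[of "min d e" "z - y"] d(1) \<open>e > 0\<close> by auto
    define w where "w = y + t *\<^sub>R (z - y)"
    have seg: "y + s *\<^sub>R (w - y) \<in> C \<inter> ball y e \<inter> ball y d" if s: "0 \<le> s" "s \<le> 1" for s
    proof -
      have "s * t * norm (z - y) \<le> t * norm (z - y)"
        using s t mult_right_mono[of s 1 "t * norm (z - y)"] by (simp add: mult.assoc)
      then have "s * t * norm (z - y) < min d e" using tn by (rule le_less_trans)
      then have "y + s *\<^sub>R (w - y) \<in> ball y e \<inter> ball y d"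
        using s t by (simp add: w_def dist_norm)
      moreover have "y + (s * t) *\<^sub>R (z - y) \<in> C"
        using convexD_alt[OF C(1) C(2) z, of "s * t"] s t
        by (simp add: mult_le_one algebra_simps)
      ultimately show ?thesis by (simp add: w_def)
    qed
    have "w \<in> U" using seg[of 1] d(2) by auto
    have "(INF x'\<in>\<psi> (s *\<^sub>R y + (1 - s) *\<^sub>R w). ereal (x' \<bullet> (w - y))) \<ge> 0"
      if s: "s \<in> {0<..<1::real}" for s
    proof (rule INF_greatest)
      fix x' assume x': "x' \<in> \<psi> (s *\<^sub>R y + (1 - s) *\<^sub>R w)"
      have eq: "s *\<^sub>R y + (1 - s) *\<^sub>R w = y + (1 - s) *\<^sub>R (w - y)"
        by (simp add: algebra_simps)
      have m: "y + (1 - s) *\<^sub>R (w - y) \<in> C \<inter> ball y e \<inter> ball y d"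
        using seg[of "1 - s"] s by simp
      then have "x' \<in> G (y + (1 - s) *\<^sub>R (w - y))"
        using x' \<psi> d(2) unfolding eq by blast
      then have "x' \<bullet> (y + (1 - s) *\<^sub>R (w - y) - y) \<ge> 0"
        using loc m by blast
      then show "0 \<le> ereal (x' \<bullet> (w - y))"
        using s by (simp add: zero_le_mult_iff)
    qed
    then have sup: "(SUP u'\<in>\<psi> y. ereal (u' \<bullet> (w - y))) \<ge> 0"
      using usc \<open>w \<in> U\<close> U(3) unfolding upper_sign_continuous_on_def by blast
    \<comment> \<open>Compactness makes the supremum attained, so its sign is realized by an actual
      element.\<close>
    have cont: "continuous_on (\<psi> y) (\<lambda>u. u \<bullet> (w - y))" by (intro continuous_intros)
    obtain u where u: "u \<in> \<psi> y" "\<And>u'. u' \<in> \<psi> y \<Longrightarrow> u' \<bullet> (w - y) \<le> u \<bullet> (w - y)"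
      using continuous_attains_sup[of "\<psi> y" "\<lambda>u. u \<bullet> (w - y)"] \<psi>[OF U(3)] cont by blast
    have "(SUP u'\<in>\<psi> y. ereal (u' \<bullet> (w - y))) \<le> ereal (u \<bullet> (w - y))"
      using u(2) by (intro SUP_least) simp
    then have "0 \<le> ereal (u \<bullet> (w - y))" using sup by (rule order_trans[rotated])
    then have "u \<bullet> (w - y) \<ge> 0" by simp
    then have "u \<bullet> (z - y) \<ge> 0"
      using t by (simp add: w_def zero_le_mult_iff)
    then show ?thesis using u(1) by blast
  qed
  then obtain u where "u \<in> \<psi> y" "\<And>z. z \<in> C \<Longrightarrow> u \<bullet> (z - y) \<ge> 0"
    using minimax_inner[of "\<psi> y" C y] \<psi>[OF U(3)] C(1) by blast
  then show thesis using that \<psi>[OF U(3)] by blast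
qed

text \<open>A point of \<open>C\<close> is approached from the interior along the segment to an
  interior point \<open>b\<close>. Along it the suprema in dual lower semi-continuity are at most 0,
  and the property passes this bound to the limit.\<close>

lemma dually_lsc_minty_from_interior:
  fixes G :: "'a::euclidean_space \<Rightarrow> 'a set"
  assumes dlsc: "dually_lsc_on K G" and C: "C \<subseteq> K" "convex C" "interior C \<noteq> {}" and y: "y \<in> K"
    and int: "\<And>z z'. z \<in> interior C \<Longrightarrow> z' \<in> G z \<Longrightarrow> z' \<bullet> (z - y) \<ge> 0"
    and z: "z \<in> C" "z' \<in> G z"
  shows "z' \<bullet> (z - y) \<ge> 0"
proof -
  obtain b where b: "b \<in> interior C" using C(3) by blast
  define x where "x n = z - (1 / real (Suc n)) *\<^sub>R (z - b)" for n
  have x: "x n \<in> interior C" for n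
    unfolding x_def by (rule mem_interior_convex_shrink[OF C(2) b z(1)]) auto
  have "x \<longlonglongrightarrow> z - 0 *\<^sub>R (z - b)"
    unfolding x_def by (intro tendsto_intros LIMSEQ_Suc[OF lim_1_over_n])
  then have lim: "x \<longlonglongrightarrow> z" by simp
  have "(SUP x'\<in>G (x n). ereal (x' \<bullet> (y - x n))) \<le> 0" for n
    using int[OF x] by (intro SUP_least) (simp add: inner_diff_right)
  then have "liminf (\<lambda>n. SUP x'\<in>G (x n). ereal (x' \<bullet> (y - x n))) \<le> liminf (\<lambda>n. 0)"
    by (intro Liminf_mono always_eventually allI)
  then have "liminf (\<lambda>n. SUP x'\<in>G (x n). ereal (x' \<bullet> (y - x n))) \<le> 0"
    by (simp add: Liminf_const)
  moreover have "\<forall>n. x n \<in> K" using x interior_subset C(1) by blast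
  ultimately have "(SUP u'\<in>G z. ereal (u' \<bullet> (y - z))) \<le> 0"
    using dlsc lim y z(1) C(1) unfolding dually_lsc_on_def by blast
  then have "ereal (z' \<bullet> (y - z)) \<le> 0"
    using z(2) by (meson SUP_upper order_trans)
  then show ?thesis by (simp add: inner_diff_right)
qed

lemma stampacchia_imp_minty:
  fixes G :: "'a::euclidean_space \<Rightarrow> 'a set"
  assumes qm: "quasimonotone_on K G" and dlsc: "dually_lsc_on K G"
    and C: "C \<subseteq> K" "convex C" "interior C \<noteq> {}" and y: "y \<in> C" "y' \<in> G y - {0}"
    and st: "\<And>z. z \<in> C \<Longrightarrow> y' \<bullet> (z - y) \<ge> 0"
  shows "y \<in> minty_solutions C G"
proof -
  have "z' \<bullet> (z - y) \<ge> 0" if z: "z \<in> interior C" "z' \<in> G z" for z z'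
  proof -
    obtain d where d: "d > 0" "cball z d \<subseteq> C"
      using z(1) mem_interior_cball by blast
    have n0: "norm y' > 0" using y(2) by simp
    \<comment> \<open>Stepping from \<open>z\<close> a distance \<open>d\<close> against
      \<open>y'\<close> stays in \<open>C\<close> and lowers the pairing by
      \<open>d * norm y'\<close>. Applying \<open>st\<close> there yields the strict inequality that
      quasimonotonicity requires.\<close>
    then have "z - (d / norm y') *\<^sub>R y' \<in> C"
      using d by (intro subsetD[OF d(2)]) (simp add: dist_norm)
    then have "y' \<bullet> (z - (d / norm y') *\<^sub>R y' - y) \<ge> 0" by (rule st)
    moreover have "y' \<bullet> (z - (d / norm y') *\<^sub>R y' - y) = y' \<bullet> (z - y) - d * norm y'"
      using n0 by (simp add: algebra_simps power2_norm_eq_inner[symmetric] power2_eq_square)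
    ultimately have "y' \<bullet> (z - y) \<ge> d * norm y'" by simp
    then have "y' \<bullet> (z - y) > 0" using d(1) n0 by (meson less_le_trans mult_pos_pos)
    then show ?thesis
      using qm y z C(1) interior_subset[of C] unfolding quasimonotone_on_def by blast
  qed
  then show ?thesis
    using dually_lsc_minty_from_interior[OF dlsc C] y(1) C(1)
    unfolding minty_solutions_def by blast
qed

lemma minty_solutions_nonempty:
  fixes G :: "'a::euclidean_space \<Rightarrow> 'a set"
  assumes lusc: "locally_upper_sign_continuous_on K G" and dlsc: "dually_lsc_on K G"
    and qm: "quasimonotone_on K G"
    and C: "C \<subseteq> K" "convex C" "interior C \<noteq> {}" "compact C"
  shows "minty_solutions C G \<noteq> {}"
proof
  assume empty: "minty_solutions C G = {}"
  define V where "V z = {y. \<forall>z'\<in>G z. z' \<bullet> (z - y) \<ge> 0}" for z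
  have closedV: "closed (V z)" for z
  proof -
    have "V z = (\<Inter>z'\<in>G z. {y. z' \<bullet> (z - y) \<ge> 0})" unfolding V_def by blast
    also have "closed \<dots>" by (intro closed_INT ballI closed_Collect_le continuous_intros)
    finally show ?thesis .
  qed
  have cov: "\<exists>z\<in>C. y \<notin> V z" if "y \<in> C" for y
    using empty that unfolding minty_solutions_def V_def by blast
  have "C \<noteq> {}" using C(3) interior_subset by blast
  then obtain x J and t :: "'a \<Rightarrow> real" where x: "x \<in> C" "finite J" "J \<subseteq> C" "J \<noteq> {}"
      "\<And>z. z \<in> J \<Longrightarrow> x \<notin> V z" "\<And>z. z \<in> J \<Longrightarrow> t z > 0"
      "\<And>w. w \<in> C \<Longrightarrow> (\<Sum>z\<in>J. t z *\<^sub>R (x - z)) \<bullet> (w - x) \<ge> 0"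
    by (rule selection_variational_inequality[OF C(4,2), of C V "\<lambda>z y. y - z"])
       (rule closedV, intro continuous_intros, erule cov, blast)
  let ?T = "sum t J"
  define c where "c = (1 / ?T) *\<^sub>R (\<Sum>z\<in>J. t z *\<^sub>R z)"
  have T: "?T > 0" using x by (simp add: sum_pos)
  have "c \<in> C" unfolding c_def using x by (intro convex_normalized_sum C) auto
  have eq: "(\<Sum>z\<in>J. t z *\<^sub>R (u - z)) = ?T *\<^sub>R (u - c)" for u
    unfolding c_def using T by (simp add: scaleR_diff_right sum_subtractf scaleR_sum_left)
  \<comment> \<open>The combined field at \<open>x\<close> is a positive multiple of
    \<open>x - c\<close>; testing it at \<open>c\<close> itself forces \<open>x = c\<close>.\<close>
  have "?T * ((x - c) \<bullet> (c - x)) \<ge> 0" using x(7)[OF \<open>c \<in> C\<close>] by (simp add: eq)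
  then have "(x - c) \<bullet> (c - x) \<ge> 0" using T by (simp add: zero_le_mult_iff)
  then have "(x - c) \<bullet> (x - c) \<le> 0" by (simp add: inner_diff_left inner_diff_right)
  then have "x = c" by (simp add: dot_square_norm)
  have "open (\<Inter>z\<in>J. - V z)" using x(2) closedV by (intro open_INT) auto
  moreover have "x \<in> (\<Inter>z\<in>J. - V z)" using x(5) by blast
  ultimately obtain e where e: "e > 0" "ball x e \<subseteq> (\<Inter>z\<in>J. - V z)"
    by (rule openE)
  have loc: "w' \<bullet> (w - x) \<ge> 0" if w: "w \<in> C \<inter> ball x e" "w' \<in> G w" for w w'
  proof -
    \<comment> \<open>Near \<open>x\<close> the Minty inequality still fails at each
      \<open>z\<close> in \<open>J\<close>. Failure means a strictly positive pairing with
      \<open>w - z\<close>, which quasimonotonicity transfers to \<open>w'\<close>; averaging over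
      \<open>J\<close> then replaces \<open>z\<close> by \<open>x\<close>.\<close>
    have "w' \<bullet> (w - z) \<ge> 0" if z: "z \<in> J" for z
    proof -
      have "w \<notin> V z" using e(2) w(1) z by blast
      then obtain z' where "z' \<in> G z" "\<not> z' \<bullet> (z - w) \<ge> 0" unfolding V_def by blast
      then have "z' \<in> G z" "z' \<bullet> (w - z) > 0" by (auto simp: inner_diff_right)
      then show ?thesis
        using qm w z x(3) C(1) unfolding quasimonotone_on_def by blast
    qed
    then have "w' \<bullet> (\<Sum>z\<in>J. t z *\<^sub>R (w - z)) \<ge> 0"
      using x(6) by (simp add: inner_sum_right sum_nonneg less_imp_le)
    then show ?thesis using T by (simp add: eq \<open>x = c\<close> zero_le_mult_iff)
  qed
  \<comment> \<open>The detour through Stampacchia turns the local Minty property into one on all of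
    \<open>C\<close>, contradicting emptiness.\<close>
  have "locally_upper_sign_continuous_at x G"
    using lusc x(1) C(1) unfolding locally_upper_sign_continuous_on_def by blast
  then obtain x' where "x' \<in> G x - {0}" "\<And>z. z \<in> C \<Longrightarrow> x' \<bullet> (z - x) \<ge> 0"
    using local_minty_imp_stampacchia[OF _ C(2) x(1) e(1) loc] by blast
  then have "x \<in> minty_solutions C G"
    using stampacchia_imp_minty[OF qm dlsc C(1-3) x(1)] by blast
  then show False using empty by blast
qed

section \<open>Convexity and closed graph of the Minty solution map\<close>

lemma convex_minty_solutions:
  assumes "convex C"
  shows "convex (minty_solutions C G)"
proof -
  have "minty_solutions C G = C \<inter> (\<Inter>z\<in>C. \<Inter>z'\<in>G z. {y. z' \<bullet> y \<le> z' \<bullet> z})"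
    unfolding minty_solutions_def by (auto simp: inner_diff_right)
  then show ?thesis
    using assms by (auto intro!: convex_Int convex_INT convex_halfspace_le)
qed

text \<open>A test point interior to the limit constraint set remains admissible for nearby
  parameters, so its inequality, being affine in \<open>y\<close>, passes to the limit. Dual lower
  semi-continuity then supplies the remaining test points.\<close>

lemma closed_graph_minty_solutions:
  fixes M :: "'p::{first_countable_topology,t2_space} \<Rightarrow> 'a::euclidean_space set"
  assumes lsc: "lsc_multimap_on P M" and cl: "closed_multimap_on P M"
    and M: "\<And>p. p \<in> P \<Longrightarrow> convex (M p)" "\<And>p. p \<in> P \<Longrightarrow> M p \<subseteq> K"
      "\<And>p. p \<in> P \<Longrightarrow> interior (M p \<inter> cball 0 r) \<noteq> {}"
    and dlsc: "dually_lsc_on K G"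
  shows "closed (SIGMA p:P. minty_solutions (M p \<inter> cball 0 r) G)"
  unfolding closed_sequential_limits
proof (intro allI impI, elim conjE)
  fix s :: "nat \<Rightarrow> 'p \<times> 'a" and l
  assume s: "\<forall>n. s n \<in> (SIGMA p:P. minty_solutions (M p \<inter> cball 0 r) G)" and lim: "s \<longlonglongrightarrow> l"
  obtain p y where l: "l = (p, y)" by (cases l)
  have limp: "(\<lambda>n. fst (s n)) \<longlonglongrightarrow> p" and limy: "(\<lambda>n. snd (s n)) \<longlonglongrightarrow> y"
    using tendsto_fst[OF lim] tendsto_snd[OF lim] by (auto simp: l)
  have sP: "fst (s n) \<in> P" and sM: "snd (s n) \<in> minty_solutions (M (fst (s n)) \<inter> cball 0 r) G" for n
    using s by (metis mem_Sigma_iff prod.collapse)+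
  have "s n \<in> Sigma P M" for n
    using sP[of n] sM[of n] unfolding minty_solutions_def by (cases "s n") auto
  then have "l \<in> Sigma P M"
    using closed_sequentially[OF cl[unfolded closed_multimap_on_def] _ lim] by blast
  then have p: "p \<in> P" "y \<in> M p" by (auto simp: l)
  have "snd (s n) \<in> cball 0 r" for n
    using sM[of n] unfolding minty_solutions_def by blast
  then have yr: "y \<in> cball 0 r"
    using closed_sequentially[OF closed_cball _ limy] by blast
  note closedM = closed_Sigma_value[OF cl[unfolded closed_multimap_on_def]]
  have int: "z' \<bullet> (z - y) \<ge> 0" if z: "z \<in> interior (M p \<inter> cball 0 r)" "z' \<in> G z" for z z'
  proof -
    have zM: "z \<in> interior (M p)" and zr: "z \<in> cball 0 r"
      using z(1) interior_subset[of "cball 0 r"] by auto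
    obtain U where U: "open U" "p \<in> U" "\<And>q. q \<in> P \<inter> U \<Longrightarrow> z \<in> M q"
      using lsc_multimap_interior_stable[OF lsc M(1) closedM p(1) zM] by blast
    have "eventually (\<lambda>n. fst (s n) \<in> U) sequentially"
      using topological_tendstoD[OF limp U(1,2)] .
    then have "eventually (\<lambda>n. z' \<bullet> (z - snd (s n)) \<ge> 0) sequentially"
    proof eventually_elim
      case (elim n)
      then have "z \<in> M (fst (s n)) \<inter> cball 0 r" using U(3) sP zr by blast
      then show ?case using sM[of n] z(2) unfolding minty_solutions_def by blast
    qed
    moreover have "(\<lambda>n. z' \<bullet> (z - snd (s n))) \<longlonglongrightarrow> z' \<bullet> (z - y)"
      by (intro tendsto_intros limy)
    ultimately show ?thesis
      by (intro tendsto_lowerbound[of _ "z' \<bullet> (z - y)" sequentially]) auto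
  qed
  have "y \<in> minty_solutions (M p \<inter> cball 0 r) G"
    unfolding minty_solutions_def
  proof (intro CollectI conjI ballI)
    fix z z' assume "z \<in> M p \<inter> cball 0 r" "z' \<in> G z"
    then show "z' \<bullet> (z - y) \<ge> 0"
      by (rule dually_lsc_minty_from_interior[OF dlsc _ _ M(3)[OF p(1)] _ int, rotated -2])
         (use M(1,2) p in \<open>auto intro: convex_Int\<close>)
  qed (use p yr in auto)
  then show "l \<in> (SIGMA p:P. minty_solutions (M p \<inter> cball 0 r) G)"
    using p l by blast
qed

section \<open>Fixed point on the truncated constraints and removal of the truncation\<close>

theorem theorem3p2:
  fixes g :: "real ^ 'n \<Rightarrow> real ^ 'm"
    and P :: "(real ^ 'm) set"
    and M :: "real ^ 'm \<Rightarrow> (real ^ 'n) set"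
    and G :: "real ^ 'n \<Rightarrow> (real ^ 'n) set"
    and \<rho> :: "real ^ 'm \<Rightarrow> real"
  assumes "affine_map g"
    and "P \<noteq> {}" and "convex P" and "compact P"
    and "\<forall>p\<in>P. convex (M p)"
    and "lsc_multimap_on P M"
    and "closed_multimap_on P M"
    and "\<forall>p\<in>P. interior (M p) \<noteq> {}"
    and "locally_upper_sign_continuous_on (convex hull (\<Union>p\<in>P. M p)) G"
    and "dually_lsc_on (convex hull (\<Union>p\<in>P. M p)) G"
    and "quasimonotone_on (convex hull (\<Union>p\<in>P. M p)) G"
    and "\<forall>p\<in>P. \<rho> p > 0 \<and> coercive_at M G p (\<rho> p)"
    and "\<exists>r::real. ereal r > (SUP p\<in>P. ereal (\<rho> p)) \<and> (\<forall>p\<in>P. M p \<inter> cball 0 r \<noteq> {})"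
  shows "\<exists>p\<^sub>0\<in>P. \<exists>y\<^sub>0\<in>M p\<^sub>0. \<exists>y'\<in>G y\<^sub>0 - {0}.
           \<forall>p\<in>P. \<forall>z\<in>M p\<^sub>0. g y\<^sub>0 \<bullet> (p - p\<^sub>0) + y' \<bullet> (z - y\<^sub>0) \<ge> 0"
proof -
  note P = assms(2-4) and lsc = assms(6) and cl = assms(7)
    and lusc = assms(9) and dlsc = assms(10) and qm = assms(11)
  define K where "K = convex hull (\<Union>p\<in>P. M p)"
  have MK: "M p \<subseteq> K" if "p \<in> P" for p
    unfolding K_def using hull_subset that by (metis SUP_upper order_trans)
  have convM: "convex (M p)" if "p \<in> P" for p using assms(5) that by blast
  obtain r where r: "ereal r > (SUP p\<in>P. ereal (\<rho> p))" "\<And>p. p \<in> P \<Longrightarrow> M p \<inter> cball 0 r \<noteq> {}"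
    using assms(13) by blast
  have \<rho>r: "\<rho> p < r" if "p \<in> P" for p
  proof -
    have "ereal (\<rho> p) \<le> (SUP p\<in>P. ereal (\<rho> p))" using that by (rule SUP_upper)
    then have "ereal (\<rho> p) < ereal r" using r(1) by (rule le_less_trans)
    then show ?thesis by simp
  qed
  \<comment> \<open>On the bounding sphere coercivity supplies \<open>b\<close>, because
    \<open>r\<close> exceeds \<open>\<rho> p\<close>; strictly inside the ball, \<open>b = y\<close>
    serves. The point \<open>b\<close> is used twice: to give the truncated sets interior, and to
    remove the truncation.\<close>
  have improve: "\<exists>b\<in>M p. norm b < r \<and> (\<forall>y'\<in>G y. y' \<bullet> (y - b) \<ge> 0)"
    if "p \<in> P" "y \<in> M p \<inter> cball 0 r" for p y
  proof (cases "norm y < r")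
    case True
    then show ?thesis using that by (intro bexI[of _ y]) auto
  next
    case False
    then have "y \<in> M p - cball 0 (\<rho> p)" "norm y = r" using that \<rho>r[of p] by auto
    then show ?thesis
      using assms(12) that(1) unfolding coercive_at_def by blast
  qed
  define C where "C p = M p \<inter> cball 0 r" for p
  have intC: "interior (C p) \<noteq> {}" if p: "p \<in> P" for p
  proof -
    obtain y where "y \<in> M p \<inter> cball 0 r" using r(2)[OF p] by blast
    then obtain b where b: "b \<in> M p" "norm b < r" using improve[OF p] by blast
    \<comment> \<open>The convex set \<open>M p\<close> lies in the closure of its interior, so the
      open ball, which contains \<open>b\<close>, meets that interior.\<close>
    then have "b \<in> closure (interior (M p)) \<inter> ball 0 r"
      using convex_closure_interior[OF convM[OF p]] assms(8) p closure_subset by fastforce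
    then have "interior (M p) \<inter> ball 0 r \<noteq> {}"
      using open_Int_closure_eq_empty[of "ball 0 r" "interior (M p)"] by auto
    then show ?thesis by (simp add: C_def)
  qed
  have closed_graph: "closed (SIGMA p:P. minty_solutions (C p) G)"
    unfolding C_def
    by (rule closed_graph_minty_solutions[OF lsc cl convM MK _ dlsc[folded K_def]])
       (use intC in \<open>auto simp: C_def\<close>)
  have convC: "convex (C p)" if "p \<in> P" for p
    unfolding C_def using convM[OF that] by (intro convex_Int) auto
  have CK: "C p \<subseteq> K" if "p \<in> P" for p using MK[OF that] by (auto simp: C_def)
  have compC: "compact (C p)" if "p \<in> P" for p
    unfolding C_def
    using closed_Sigma_value[OF cl[unfolded closed_multimap_on_def] that]
    by (intro closed_Int_compact compact_cball)
  have contg: "continuous_on UNIV g"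
  proof -
    obtain L c where "linear L" "g = (\<lambda>x. L x + c)"
      using assms(1) unfolding affine_map_def by blast
    then show ?thesis
      by (simp add: continuous_on_add linear_continuous_on linear_conv_bounded_linear)
  qed
  define A where "A y = {q \<in> P. \<forall>p\<in>P. g y \<bullet> (p - q) \<ge> 0}" for y
  \<comment> \<open>Each component reads only the other coordinate, so a fixed point couples them:
    \<open>p\<close> minimizes the pairing with \<open>g y\<close>, and \<open>y\<close> is a Minty
    solution for \<open>p\<close>. The domain \<open>X\<close> takes the full ball, since it must
    not depend on \<open>p\<close>.\<close>
  define F where "F x = A (snd x) \<times> minty_solutions (C (fst x)) G" for x
  define X where "X = P \<times> (cball 0 r :: (real ^ 'n) set)"
  have "r > 0"
    using P(1) \<rho>r assms(12) by (meson ex_in_conv less_trans)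
  have X: "compact X" "convex X" "X \<noteq> {}"
    unfolding X_def using P \<open>r > 0\<close> by (auto intro: compact_Times convex_Times)
  have A_nonempty: "A y \<noteq> {}" for y
  proof -
    have "continuous_on P (\<lambda>q. g y \<bullet> q)" by (intro continuous_intros)
    then obtain q where "q \<in> P" "\<forall>p\<in>P. g y \<bullet> q \<le> g y \<bullet> p"
      using continuous_attains_inf[OF P(3,1)] by blast
    then show ?thesis unfolding A_def by (auto simp: inner_diff_right)
  qed
  have A_convex: "convex (A y)" for y
  proof -
    have "A y = P \<inter> (\<Inter>p\<in>P. {q. g y \<bullet> q \<le> g y \<bullet> p})"
      unfolding A_def by (auto simp: inner_diff_right)
    then show ?thesis using P(2) by (auto intro!: convex_Int convex_INT convex_halfspace_le)
  qed
  have "F x \<noteq> {} \<and> convex (F x) \<and> F x \<subseteq> X" if "x \<in> X" for x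
  proof -
    have p: "fst x \<in> P" using that by (auto simp: X_def)
    have "minty_solutions (C (fst x)) G \<noteq> {}"
      using minty_solutions_nonempty[of K G "C (fst x)"] lusc dlsc qm CK convC intC compC p
      unfolding K_def by blast
    moreover have "F x \<subseteq> X"
      unfolding F_def X_def A_def minty_solutions_def C_def by blast
    ultimately show ?thesis
      unfolding F_def using A_nonempty A_convex convex_minty_solutions[OF convC[OF p]]
      by (auto intro: convex_Times)
  qed
  moreover have "closed (Sigma X F)"
  proof -
    have "Sigma X F = (X \<times> (P \<times> UNIV))
        \<inter> (\<Inter>p\<in>P. {w. g (snd (fst w)) \<bullet> (p - fst (snd w)) \<ge> 0})
        \<inter> (\<lambda>w. (fst (fst w), snd (snd w))) -` (SIGMA p:P. minty_solutions (C p) G)"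
      unfolding F_def A_def X_def by auto
    moreover have "closed (X \<times> (P \<times> (UNIV :: (real ^ 'n) set)))"
      using X(1) P(3) by (intro closed_Times compact_imp_closed closed_UNIV)
    moreover have "closed {w :: ((real ^ 'm) \<times> (real ^ 'n)) \<times> ((real ^ 'm) \<times> (real ^ 'n)).
        g (snd (fst w)) \<bullet> (p - fst (snd w)) \<ge> 0}" for p
      by (intro closed_Collect_le continuous_intros continuous_on_compose2[OF contg]) auto
    moreover have "closed ((\<lambda>w :: ((real ^ 'm) \<times> (real ^ 'n)) \<times> ((real ^ 'm) \<times> (real ^ 'n)).
        (fst (fst w), snd (snd w))) -` (SIGMA p:P. minty_solutions (C p) G))"
      by (rule closed_vimage[OF closed_graph]) (intro continuous_intros)
    ultimately show ?thesis by (auto intro!: closed_Int closed_INT)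
  qed
  ultimately obtain x where "x \<in> X" "x \<in> F x"
    using kakutani[OF X, of F] by blast
  then obtain p0 y0 where p0: "p0 \<in> P" "\<And>p. p \<in> P \<Longrightarrow> g y0 \<bullet> (p - p0) \<ge> 0"
    and y0: "y0 \<in> minty_solutions (C p0) G"
    unfolding X_def F_def A_def by (cases x) auto
  have y0C: "y0 \<in> C p0" using y0 by (simp add: minty_solutions_def)
  have "locally_upper_sign_continuous_at y0 G"
    using lusc y0C CK[OF p0(1)] unfolding locally_upper_sign_continuous_on_def K_def by blast
  \<comment> \<open>The radius 1 is arbitrary, as the Minty inequality holds on all of
    \<open>C p0\<close>.\<close>
  then obtain y' where y': "y' \<in> G y0 - {0}" "\<And>z. z \<in> C p0 \<Longrightarrow> y' \<bullet> (z - y0) \<ge> 0"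
    using local_minty_imp_stampacchia[OF _ convC[OF p0(1)] y0C zero_less_one, of G] y0
    unfolding minty_solutions_def by blast
  \<comment> \<open>Coercivity and the truncated inequality bound the pairing at \<open>b\<close>
    from both sides, so \<open>y'\<close> takes the same value at \<open>b\<close> and
    \<open>y0\<close>. Since \<open>b\<close> lies strictly inside the ball, a short step from
    \<open>b\<close> towards any \<open>z\<close> in \<open>M p0\<close> stays in
    \<open>C p0\<close>, and its pairing has the sign of that at \<open>z\<close>.\<close>
  obtain b where b: "b \<in> M p0" "norm b < r" "y' \<bullet> (y0 - b) \<ge> 0"
    using improve[OF p0(1)] y0C y'(1) unfolding C_def by blast
  have "y' \<bullet> (b - y0) \<ge> 0" using y'(2)[of b] b by (simp add: C_def)
  then have b0: "y' \<bullet> b = y' \<bullet> y0" using b(3) by (simp add: inner_diff_right)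
  have "y' \<bullet> (z - y0) \<ge> 0" if z: "z \<in> M p0" for z
  proof -
    obtain t where t: "t > 0" "t \<le> 1" and tn: "t * norm (z - b) < r - norm b"
      using small_scaling[of "r - norm b" "z - b"] b(2) by auto
    have "norm (b + t *\<^sub>R (z - b)) \<le> r"
      using tn norm_triangle_ineq[of b "t *\<^sub>R (z - b)"] t by simp
    moreover have "b + t *\<^sub>R (z - b) \<in> M p0"
      using convexD_alt[OF convM[OF p0(1)] b(1) z, of t] t by (simp add: algebra_simps)
    ultimately have "y' \<bullet> (b + t *\<^sub>R (z - b) - y0) \<ge> 0"
      by (intro y'(2)) (simp add: C_def)
    then have "t * (y' \<bullet> (z - y0)) \<ge> 0"
      using b0 by (simp add: inner_diff_right inner_add_right)
    then show ?thesis using t by (simp add: zero_le_mult_iff)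
  qed
  then show ?thesis
    using p0 y' y0C unfolding C_def
    by (intro bexI[of _ p0] bexI[of _ y0] bexI[of _ y']) (auto intro: add_nonneg_nonneg)
qed

end
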